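(* Let $m,n\ge2$. There exist languages $K$ and $L$ over a common three-letter alphabet with $\kappa(K)=m$ and $\kappa(L)=n$ such that the subset automaton of the shuffle NFA $\mathcal{N}$ accepting $K \sqcup\!\sqcup L$ (with $mn$ states, constructed from the minimal complete DFAs of $K$ and $L$) does not have equivalent states; that is, any two distinct states among its $2^{mn}$ states are distinguishable.
   Context: The state complexity $\kappa(L)$ of a regular language $L$ over $\Sigma$ is the number of states of the minimal complete deterministic finite automaton (DFA) over $\Sigma$ recognizing $L$. The shuffle of words $u,v\in\Sigma^*$ is $u \sqcup\!\sqcup v=\{u_1v_1\cdots u_kv_k \mid u=u_1\cdots u_k,\ v=v_1\cdots v_k,\ u_i,v_i\in\Sigma^*\}$, and $K \sqcup\!\sqcup L=\bigcup_{u\in K,\,v\in L} u \sqcup\!\sqcup v$. An NFA is $\mathcal{A}=(Q,\Sigma,\delta,s,F)$ with a single initial state $s$ and $\delta\colon Q\times\Sigma\to 2^Q$, extended to $2^Q\times\Sigma^*$ in the natural way. Its subset automaton is the DFA $(2^Q,\Sigma,\delta,\{s\},F')$ with all $2^{|Q|}$ subsets of $Q$ as states, where $F'=\{R\subseteq Q\mid R\cap F\ne\emptyset\}$. Two states of a DFA are equivalent if exactly the same words are accepted from them, and distinguishable otherwise. Shuffle NFA: if $K$ and $L$ are recognized by complete DFAs $(Q_K,\Sigma,\delta_K,q_K,F_K)$ and $(Q_L,\Sigma,\delta_L,q_L,F_L)$, then $K \sqcup\!\sqcup L$ is accepted by the NFA $\mathcal{N}=(Q_K\times Q_L,\Sigma,\delta,(q_K,q_L),F_K\times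 F_L)$ where $\delta((p,q),a)=\{(\delta_K(p,a),q),(p,\delta_L(q,a))\}$. *)

theory Defs
  imports Main
begin

record ('q, 'a) dfa =
  dstates :: "'q set"
  dalphabet :: "'a set"
  dstep :: "'q \<Rightarrow> 'a \<Rightarrow> 'q"
  dinit :: 'q
  dfinal :: "'q set"

definition complete_dfa :: "('q, 'a) dfa \<Rightarrow> bool" where
  "complete_dfa A \<longleftrightarrow>
     finite (dstates A) \<and> finite (dalphabet A) \<and>
     dinit A \<in> dstates A \<and> dfinal A \<subseteq> dstates A \<and>
     (\<forall>q\<in>dstates A. \<forall>a\<in>dalphabet A. dstep A q a \<in> dstates A)"

definition dfa_lang_from :: "('q, 'a) dfa \<Rightarrow> 'q \<Rightarrow> 'a list set" where
  "dfa_lang_from A q = {w \<in> lists (dalphabet A). foldl (dstep A) q w \<in> dfinal A}"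

definition dfa_lang :: "('q, 'a) dfa \<Rightarrow> 'a list set" where
  "dfa_lang A = dfa_lang_from A (dinit A)"

definition equivalent_states :: "('q, 'a) dfa \<Rightarrow> 'q \<Rightarrow> 'q \<Rightarrow> bool" where
  "equivalent_states A p q \<longleftrightarrow> dfa_lang_from A p = dfa_lang_from A q"

definition recognizes :: "('q, 'a) dfa \<Rightarrow> 'a set \<Rightarrow> 'a list set \<Rightarrow> bool" where
  "recognizes A \<Sigma> K \<longleftrightarrow> complete_dfa A \<and> dalphabet A = \<Sigma> \<and> dfa_lang A = K"

(* Below, states are natural numbers. This is no restriction, since every complete DFA is
   finite and hence isomorphic to one whose states are natural numbers. *)

definition regular_over :: "'a set \<Rightarrow> 'a list set \<Rightarrow> bool" where
  "regular_over \<Sigma> K \<longleftrightarrow> (\<exists>A :: (nat, 'a) dfa. recognizes A \<Sigma> K)"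

definition minimal_dfa :: "(nat, 'a) dfa \<Rightarrow> 'a set \<Rightarrow> 'a list set \<Rightarrow> bool" where
  "minimal_dfa A \<Sigma> K \<longleftrightarrow>
     recognizes A \<Sigma> K \<and>
     (\<forall>B :: (nat, 'a) dfa. recognizes B \<Sigma> K \<longrightarrow> card (dstates A) \<le> card (dstates B))"

(* Only meaningful if K is regular over the alphabet. *)
definition state_complexity :: "'a set \<Rightarrow> 'a list set \<Rightarrow> nat" where
  "state_complexity \<Sigma> K =
     (LEAST k. \<exists>A :: (nat, 'a) dfa. recognizes A \<Sigma> K \<and> card (dstates A) = k)"

record ('q, 'a) nfa =
  nstates :: "'q set"
  nalphabet :: "'a set"
  nstep :: "'q \<Rightarrow> 'a \<Rightarrow> 'q set"
  ninit :: 'q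
  nfinal :: "'q set"

definition nfa_step :: "('q, 'a) nfa \<Rightarrow> 'q set \<Rightarrow> 'a \<Rightarrow> 'q set" where
  "nfa_step N R a = (\<Union>q\<in>R. nstep N q a)"

definition nfa_lang :: "('q, 'a) nfa \<Rightarrow> 'a list set" where
  "nfa_lang N =
     {w \<in> lists (nalphabet N). foldl (nfa_step N) {ninit N} w \<inter> nfinal N \<noteq> {}}"

(* All subsets of the state set are states, whether reachable or not. *)
definition subset_automaton :: "('q, 'a) nfa \<Rightarrow> ('q set, 'a) dfa" where
  "subset_automaton N =
     \<lparr>dstates = Pow (nstates N),
      dalphabet = nalphabet N,
      dstep = nfa_step N,
      dinit = {ninit N},
      dfinal = {R. R \<subseteq> nstates N \<and> R \<inter> nfinal N \<noteq> {}}\<rparr>"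

(* The library function shuffles yields the set of all interleavings of two words. *)
definition shuffle_lang :: "'a list set \<Rightarrow> 'a list set \<Rightarrow> 'a list set" where
  "shuffle_lang K L = (\<Union>u\<in>K. \<Union>v\<in>L. shuffles u v)"

(* Intended for automata over the same alphabet. *)
definition shuffle_nfa :: "('p, 'a) dfa \<Rightarrow> ('q, 'a) dfa \<Rightarrow> ('p \<times> 'q, 'a) nfa" where
  "shuffle_nfa A B =
     \<lparr>nstates = dstates A \<times> dstates B,
      nalphabet = dalphabet A,
      nstep = (\<lambda>(p, q) a. {(dstep A p a, q), (p, dstep B q a)}),
      ninit = (dinit A, dinit B),
      nfinal = dfinal A \<times> dfinal B\<rparr>"

end

theory Submission
  imports Defs
begin

text \<open>Since \<open>R\<close> and \<open>R - {x}\<close> must be distinguishable for every \<open>x \<in> R\<close>, the claim holds iff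
  every state \<open>(p, q)\<close> of the shuffle NFA admits a word accepted from \<open>(p, q)\<close> and from no other
  state. Take \<open>F\<^sub>K = {m - 1}\<close> and \<open>F\<^sub>L = {n - 1}\<close>, so the empty word works for \<open>(m - 1, n - 1)\<close>, and
  move backwards. Letter \<open>0\<close> is a cycle on \<open>Q\<^sub>K\<close> and sends all of \<open>Q\<^sub>L\<close> to \<open>0\<close>; hence for \<open>q \<noteq> 0\<close>
  the only state with a \<open>0\<close>-transition into \<open>(p + 1, q)\<close> is \<open>(p, q)\<close>. Letter \<open>1\<close> is symmetric, and
  the two together reach all states but \<open>(0, 0)\<close>. Letter \<open>2\<close> has \<open>(0, 0)\<close> as the only predecessor
  of \<open>(1, 0)\<close>. For arbitrary minimal DFAs, acceptance from a state of the shuffle NFA depends only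
  on the languages of its two components.\<close>

section \<open>Residual languages and minimality of DFAs\<close>

lemma Nil_in_dfa_lang_from [simp]: "[] \<in> dfa_lang_from A q \<longleftrightarrow> q \<in> dfinal A"
  by (simp add: dfa_lang_from_def)

lemma Cons_in_dfa_lang_from [simp]:
  "a # w \<in> dfa_lang_from A q \<longleftrightarrow> a \<in> dalphabet A \<and> w \<in> dfa_lang_from A (dstep A q a)"
  by (auto simp: dfa_lang_from_def)

lemma dfa_lang_from_foldl:
  assumes "u \<in> lists (dalphabet A)"
  shows "dfa_lang_from A (foldl (dstep A) q u) = {w. u @ w \<in> dfa_lang_from A q}"
  using assms by (induction u arbitrary: q) auto

lemma foldl_dstep_in_dstates:
  assumes "complete_dfa A" "q \<in> dstates A" "w \<in> lists (dalphabet A)"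
  shows "foldl (dstep A) q w \<in> dstates A"
  using assms(2,3) by (induction w arbitrary: q) (use assms(1) in \<open>auto simp: complete_dfa_def\<close>)

text \<open>The Myhill-Nerode criterion for minimality. In contrast to \<open>minimal_dfa\<close> it
  involves no other automaton, so it can be checked directly for concrete DFAs.\<close>

definition reduced_dfa :: "('q, 'a) dfa \<Rightarrow> bool" where
  "reduced_dfa A \<longleftrightarrow>
     (\<forall>q\<in>dstates A. \<exists>w\<in>lists (dalphabet A). foldl (dstep A) (dinit A) w = q) \<and>
     inj_on (dfa_lang_from A) (dstates A)"

text \<open>A word \<open>u\<close> leading to a state of \<open>A\<close> fixes the language of
  that state as the left quotient of \<open>K\<close> by \<open>u\<close>, and \<open>B\<close> has
  the same quotient at the state that it reaches on \<open>u\<close>.\<close>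

lemma reduced_dfa_residuals_subset:
  assumes "recognizes A \<Sigma> K" "reduced_dfa A" "recognizes B \<Sigma> K"
  shows "dfa_lang_from A ` dstates A \<subseteq> dfa_lang_from B ` dstates B"
proof
  have A: "dalphabet A = \<Sigma>" "dfa_lang_from A (dinit A) = K"
    and B: "dalphabet B = \<Sigma>" "dfa_lang_from B (dinit B) = K" "complete_dfa B" "dinit B \<in> dstates B"
    using assms(1,3) by (auto simp: recognizes_def dfa_lang_def complete_dfa_def)
  fix X assume "X \<in> dfa_lang_from A ` dstates A"
  then obtain q where "q \<in> dstates A" and q: "X = dfa_lang_from A q" by (elim imageE)
  then obtain u where u: "u \<in> lists \<Sigma>" and uq: "foldl (dstep A) (dinit A) u = q"
    using assms(2) A(1) unfolding reduced_dfa_def by metis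
  have "X = {w. u @ w \<in> K}"
    using u A dfa_lang_from_foldl[of u A "dinit A"] by (simp only: q uq)
  moreover have "dfa_lang_from B (foldl (dstep B) (dinit B) u) = {w. u @ w \<in> K}"
    using u B by (simp only: dfa_lang_from_foldl)
  moreover have "foldl (dstep B) (dinit B) u \<in> dstates B"
    using u B by (simp add: foldl_dstep_in_dstates)
  ultimately show "X \<in> dfa_lang_from B ` dstates B" by blast
qed

lemma reduced_dfa_card_le:
  assumes "recognizes A \<Sigma> K" "reduced_dfa A" "recognizes B \<Sigma> K"
  shows "card (dstates A) \<le> card (dstates B)"
proof -
  have "card (dstates A) = card (dfa_lang_from A ` dstates A)"
    using assms(2) by (simp add: card_image reduced_dfa_def)
  also have "\<dots> \<le> card (dstates B)"
    using assms(3) reduced_dfa_residuals_subset[OF assms]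
    by (intro surj_card_le[where f = "dfa_lang_from B"]) (auto simp: recognizes_def complete_dfa_def)
  finally show ?thesis .
qed

lemma reduced_dfa_state_complexity:
  fixes A :: "(nat, 'a) dfa"
  assumes "recognizes A \<Sigma> K" "reduced_dfa A"
  shows "state_complexity \<Sigma> K = card (dstates A)"
  unfolding state_complexity_def
  using assms by (intro Least_equality) (auto dest: reduced_dfa_card_le)

text \<open>The residuals of \<open>A\<close> occur among those of \<open>B\<close>, while
  \<open>B\<close> has no more states than \<open>A\<close>; counting leaves no room for further
  residuals or repetitions in \<open>B\<close>. This takes the place of an isomorphism between the
  two automata.\<close>

lemma minimal_dfa_residuals:
  fixes A :: "(nat, 'a) dfa"
  assumes A: "recognizes A \<Sigma> K" "reduced_dfa A" and B: "minimal_dfa B \<Sigma> K"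
  shows "card (dstates B) = card (dstates A)"
    and "dfa_lang_from B ` dstates B = dfa_lang_from A ` dstates A"
    and "inj_on (dfa_lang_from B) (dstates B)"
proof -
  have rB: "recognizes B \<Sigma> K" and fin: "finite (dstates B)"
    using B by (auto simp: minimal_dfa_def recognizes_def complete_dfa_def)
  show card: "card (dstates B) = card (dstates A)"
    using A(1) B reduced_dfa_card_le[OF A rB] unfolding minimal_dfa_def by (blast intro: antisym)
  have sub: "dfa_lang_from A ` dstates A \<subseteq> dfa_lang_from B ` dstates B"
    by (rule reduced_dfa_residuals_subset[OF A rB])
  have cA: "card (dfa_lang_from A ` dstates A) = card (dstates A)"
    using A(2) by (simp add: card_image reduced_dfa_def)
  have "card (dfa_lang_from B ` dstates B) \<le> card (dfa_lang_from A ` dstates A)"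
    using card_image_le[OF fin, of "dfa_lang_from B"] card cA by simp
  then show eq: "dfa_lang_from B ` dstates B = dfa_lang_from A ` dstates A"
    using card_seteq[OF _ sub] fin by simp
  show "inj_on (dfa_lang_from B) (dstates B)"
    by (rule eq_card_imp_inj_on[OF fin]) (simp add: eq card cA)
qed

section \<open>Acceptance in the shuffle NFA through the languages of the components\<close>

lemma Nil_in_shuffle_lang [simp]: "[] \<in> shuffle_lang K L \<longleftrightarrow> [] \<in> K \<and> [] \<in> L"
  by (auto simp: shuffle_lang_def)

text \<open>The two disjuncts mirror the two transitions of the shuffle NFA: the letter is consumed
  by one component or by the other.\<close>

lemma Cons_in_shuffle_lang:
  "a # w \<in> shuffle_lang K L \<longleftrightarrow>
     w \<in> shuffle_lang {u. a # u \<in> K} L \<or> w \<in> shuffle_lang K {v. a # v \<in> L}" (is "?l \<longleftrightarrow> ?r")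
proof
  assume ?l
  then obtain u v where uv: "u \<in> K" "v \<in> L" and "a # w \<in> shuffles u v"
    by (auto simp: shuffle_lang_def)
  then consider u' where "u = a # u'" "w \<in> shuffles u' v" | v' where "v = a # v'" "w \<in> shuffles u v'"
    unfolding Cons_in_shuffles_iff by (cases u; cases v) auto
  then show ?r
    using uv unfolding shuffle_lang_def by cases blast+
next
  assume ?r
  then show ?l
    unfolding shuffle_lang_def by (auto intro: Cons_in_shuffles_leftI Cons_in_shuffles_rightI)
qed

lemma Cons_in_shuffle_dfa_lang_from:
  assumes "dalphabet B = dalphabet A"
  shows "a # w \<in> shuffle_lang (dfa_lang_from A p) (dfa_lang_from B q) \<longleftrightarrow>
    a \<in> dalphabet A \<and>
    (w \<in> shuffle_lang (dfa_lang_from A (dstep A p a)) (dfa_lang_from B q) \<or>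
     w \<in> shuffle_lang (dfa_lang_from A p) (dfa_lang_from B (dstep B q a)))"
  unfolding Cons_in_shuffle_lang using assms by (auto simp: shuffle_lang_def)

text \<open>The induction has to range over all sets \<open>R\<close>, as one step turns a single
  pair into a set. Each disjunct of \<open>Cons_in_shuffle_dfa_lang_from\<close> is one successor of
  the pair.\<close>

lemma shuffle_nfa_accepts_iff:
  assumes "dalphabet B = dalphabet A"
  shows "w \<in> lists (dalphabet A) \<and>
      foldl (nfa_step (shuffle_nfa A B)) R w \<inter> nfinal (shuffle_nfa A B) \<noteq> {} \<longleftrightarrow>
    (\<exists>(p, q)\<in>R. w \<in> shuffle_lang (dfa_lang_from A p) (dfa_lang_from B q))"
proof (induction w arbitrary: R)
  case Nil
  then show ?case by (auto simp: shuffle_nfa_def)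
next
  case (Cons a w)
  have "a # w \<in> lists (dalphabet A) \<and>
      foldl (nfa_step (shuffle_nfa A B)) R (a # w) \<inter> nfinal (shuffle_nfa A B) \<noteq> {} \<longleftrightarrow>
    a \<in> dalphabet A \<and> (\<exists>(p, q)\<in>nfa_step (shuffle_nfa A B) R a.
      w \<in> shuffle_lang (dfa_lang_from A p) (dfa_lang_from B q))"
    unfolding Cons.IH[symmetric] by auto
  also have "\<dots> \<longleftrightarrow>
    (\<exists>(p, q)\<in>R. a # w \<in> shuffle_lang (dfa_lang_from A p) (dfa_lang_from B q))"
    unfolding Cons_in_shuffle_dfa_lang_from[OF assms]
    by (simp add: nfa_step_def shuffle_nfa_def Bex_def split_beta) blast
  finally show ?case .
qed

lemma nfa_lang_shuffle_nfa:
  assumes "dalphabet B = dalphabet A"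
  shows "nfa_lang (shuffle_nfa A B) = shuffle_lang (dfa_lang A) (dfa_lang B)"
  using shuffle_nfa_accepts_iff[OF assms, of _ "{(dinit A, dinit B)}"]
  by (auto simp: nfa_lang_def dfa_lang_def shuffle_nfa_def)

lemma foldl_nfa_step_shuffle_nfa_subset:
  assumes "complete_dfa A" "complete_dfa B" "dalphabet B = dalphabet A"
    and "R \<subseteq> dstates A \<times> dstates B" "w \<in> lists (dalphabet A)"
  shows "foldl (nfa_step (shuffle_nfa A B)) R w \<subseteq> dstates A \<times> dstates B"
  using assms(4,5)
proof (induction w arbitrary: R)
  case (Cons a w)
  have "nfa_step (shuffle_nfa A B) R a \<subseteq> dstates A \<times> dstates B"
    using Cons.prems assms(1-3) by (auto simp: nfa_step_def shuffle_nfa_def complete_dfa_def)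
  then show ?case using Cons by simp
qed simp

lemma subset_automaton_shuffle_nfa_lang_from:
  assumes "complete_dfa A" "complete_dfa B" "dalphabet B = dalphabet A"
    and "R \<subseteq> dstates A \<times> dstates B"
  shows "w \<in> dfa_lang_from (subset_automaton (shuffle_nfa A B)) R \<longleftrightarrow>
    (\<exists>(p, q)\<in>R. w \<in> shuffle_lang (dfa_lang_from A p) (dfa_lang_from B q))"
  unfolding shuffle_nfa_accepts_iff[OF assms(3), symmetric]
  \<comment> \<open>Final states of the subset automaton are subsets of the NFA's state set, so the
    set reached must be known to stay inside the product.\<close>
  using foldl_nfa_step_shuffle_nfa_subset[OF assms, of w]
  by (auto simp: dfa_lang_from_def subset_automaton_def shuffle_nfa_def)

section \<open>The two witness DFAs\<close>

lemma foldl_cycle: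
  assumes "\<And>q. q < k \<Longrightarrow> \<delta> q a = Suc q mod k" "q < k"
  shows "foldl \<delta> q (replicate i a) = (q + i) mod k"
  using assms(2)
proof (induction i arbitrary: q)
  case (Suc i)
  have "foldl \<delta> q (replicate (Suc i) a) = (Suc q mod k + i) mod k"
    using Suc by (simp add: assms(1))
  then show ?case by (simp add: mod_simps)
qed simp

text \<open>Powers of \<open>a\<close> suffice: from \<open>0\<close> they reach every state, and
  the power \<open>k - 1 - p\<close> leads to the final state from \<open>p\<close> alone.\<close>

lemma reduced_cyclic_dfa:
  assumes A: "dstates A = {..<k}" "dinit A = 0" "dfinal A = {k - 1}" "a \<in> dalphabet A"
    and step: "\<And>q. q < k \<Longrightarrow> dstep A q a = Suc q mod k"
  shows "reduced_dfa A"
proof -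
  note fold = foldl_cycle[where \<delta> = "dstep A", OF step]
  have "\<exists>w\<in>lists (dalphabet A). foldl (dstep A) (dinit A) w = q" if "q < k" for q
    using that A by (intro bexI[of _ "replicate q a"]) (auto simp: fold)
  moreover have "inj_on (dfa_lang_from A) {..<k}"
  proof (rule inj_onI)
    fix p q assume pq: "p \<in> {..<k}" "q \<in> {..<k}" and eq: "dfa_lang_from A p = dfa_lang_from A q"
    have "replicate (k - 1 - p) a \<in> dfa_lang_from A p"
      using pq A by (auto simp: dfa_lang_from_def fold)
    then have "(q + (k - 1 - p)) mod k = k - 1"
      using pq A unfolding eq by (auto simp: dfa_lang_from_def fold)
    \<comment> \<open>For \<open>q \<le> p\<close> the sum stays below \<open>k\<close>, which gives
      \<open>p = q\<close>; for \<open>q > p\<close> it wraps around to \<open>q - p - 1\<close>,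
      which is less than \<open>k - 1\<close>.\<close>
    then show "p = q"
      using pq by (cases "q \<le> p") (auto simp: mod_if split: if_splits)
  qed
  ultimately show ?thesis using A(1) by (simp add: reduced_dfa_def)
qed

text \<open>Letter \<open>2\<close> enters state \<open>1\<close> from \<open>0\<close> only,
  whereas in \<open>right_dfa\<close> it always leads to \<open>1\<close>, never to
  \<open>0\<close>; both choices serve the pair \<open>(0, 0)\<close>.\<close>

definition left_dfa :: "nat \<Rightarrow> (nat, nat) dfa" where
  "left_dfa m = \<lparr>dstates = {..<m}, dalphabet = {0, 1, 2},
     dstep = (\<lambda>p a. if a = 0 then Suc p mod m else if a = 1 then 0 else if p = 0 then 1 else 0),
     dinit = 0, dfinal = {m - 1}\<rparr>"

definition right_dfa :: "nat \<Rightarrow> (nat, nat) dfa" where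
  "right_dfa n = \<lparr>dstates = {..<n}, dalphabet = {0, 1, 2},
     dstep = (\<lambda>q a. if a = 0 then 0 else if a = 1 then Suc q mod n else 1),
     dinit = 0, dfinal = {n - 1}\<rparr>"

lemma left_dfa:
  assumes "m \<ge> 2"
  shows "recognizes (left_dfa m) {0, 1, 2} (dfa_lang (left_dfa m))" "reduced_dfa (left_dfa m)"
proof -
  show "recognizes (left_dfa m) {0, 1, 2} (dfa_lang (left_dfa m))"
    using assms by (auto simp: recognizes_def complete_dfa_def left_dfa_def)
  show "reduced_dfa (left_dfa m)"
    by (rule reduced_cyclic_dfa[where k = m and a = 0]) (auto simp: left_dfa_def)
qed

lemma right_dfa:
  assumes "n \<ge> 2"
  shows "recognizes (right_dfa n) {0, 1, 2} (dfa_lang (right_dfa n))" "reduced_dfa (right_dfa n)"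
proof -
  show "recognizes (right_dfa n) {0, 1, 2} (dfa_lang (right_dfa n))"
    using assms by (auto simp: recognizes_def complete_dfa_def right_dfa_def)
  show "reduced_dfa (right_dfa n)"
    by (rule reduced_cyclic_dfa[where k = n and a = 1]) (auto simp: right_dfa_def)
qed

section \<open>Words accepted from a single pair of states\<close>

lemma Suc_mod_eq_Suc_iff:
  assumes "i < k" "Suc j < k"
  shows "Suc i mod k = Suc j \<longleftrightarrow> i = j"
  \<comment> \<open>The wrap-around value \<open>0\<close> differs from
    \<open>Suc j\<close>.\<close>
  using assms by (cases "Suc i = k") auto

lemma unique_word:
  assumes m: "m \<ge> 2" and n: "n \<ge> 2" and "p < m" "q < n"
  shows "\<exists>w. \<forall>i<m. \<forall>j<n. w \<in> shuffle_lang (dfa_lang_from (left_dfa m) i)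
    (dfa_lang_from (right_dfa n) j) \<longleftrightarrow> i = p \<and> j = q"
proof -
  define S where "S i j = shuffle_lang (dfa_lang_from (left_dfa m) i)
    (dfa_lang_from (right_dfa n) j)" for i j
  \<comment> \<open>Hiding the word behind an existential lets the inductions below run over pairs
    only; each step prepends one letter.\<close>
  define U where "U p q \<longleftrightarrow> (\<exists>w. \<forall>i<m. \<forall>j<n. w \<in> S i j \<longleftrightarrow> i = p \<and> j = q)" for p q
  have alph: "dalphabet (right_dfa n) = dalphabet (left_dfa m)"
    by (simp add: left_dfa_def right_dfa_def)
  have S0: "0 # w \<in> S i j \<longleftrightarrow> w \<in> S (Suc i mod m) j \<or> w \<in> S i 0"
    and S1: "1 # w \<in> S i j \<longleftrightarrow> w \<in> S 0 j \<or> w \<in> S i (Suc j mod n)"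
    and S2: "2 # w \<in> S i j \<longleftrightarrow> w \<in> S (if i = 0 then 1 else 0) j \<or> w \<in> S i 1" for i j w
    unfolding S_def Cons_in_shuffle_dfa_lang_from[OF alph]
    by (simp_all add: left_dfa_def right_dfa_def)
  have step0: "U p q" if U: "U (Suc p) q" and "Suc p < m" "0 < q" "q < n" for p q
  proof -
    obtain w where w: "\<And>i j. i < m \<Longrightarrow> j < n \<Longrightarrow> w \<in> S i j \<longleftrightarrow> i = Suc p \<and> j = q"
      using U unfolding U_def by blast
    \<comment> \<open>The option \<open>w \<in> S i 0\<close> fails because \<open>0 < q\<close>;
      the other one forces \<open>i = p\<close> because \<open>Suc p\<close> is not the wrap-around
      value.\<close>
    show ?thesis
      unfolding U_def using that m by (intro exI[of _ "0 # w"]) (auto simp: S0 w Suc_mod_eq_Suc_iff)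
  qed
  have step1: "U p q" if U: "U p (Suc q)" and "0 < p" "p < m" "Suc q < n" for p q
  proof -
    obtain w where w: "\<And>i j. i < m \<Longrightarrow> j < n \<Longrightarrow> w \<in> S i j \<longleftrightarrow> i = p \<and> j = Suc q"
      using U unfolding U_def by blast
    show ?thesis
      unfolding U_def using that n by (intro exI[of _ "1 # w"]) (auto simp: S1 w Suc_mod_eq_Suc_iff simp del: One_nat_def)
  qed
  have corner: "U (m - 1) (n - 1)"
    unfolding U_def S_def by (intro exI[of _ "[]"]) (auto simp: left_dfa_def right_dfa_def)
  \<comment> \<open>Backward walk from the corner: along \<open>q = n - 1\<close> by letter
    \<open>0\<close>, then for each \<open>p > 0\<close> through all \<open>q\<close> by letter
    \<open>1\<close>, then for each \<open>q > 0\<close> through all \<open>p\<close> by letter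
    \<open>0\<close>, which adds the pairs \<open>(0, q)\<close>.\<close>
  have last_row: "U p (n - 1)" if "p \<le> m - 1" for p
    using that by (induction p rule: inc_induct) (use corner step0 n in auto)
  have pos_column: "U p q" if "q \<le> n - 1" "0 < p" "p < m" for p q
    using that(1) by (induction q rule: inc_induct) (use last_row step1 that in auto)
  have pos_row: "U p q" if "p \<le> m - 1" "0 < q" "q < n" for p q
    using that(1) by (induction p rule: inc_induct) (use pos_column[of q "m - 1"] step0 m that in auto)
  \<comment> \<open>Letter \<open>0\<close> is of no use for going back from \<open>(1, 0)\<close>,
    since it takes every \<open>(1, j)\<close> there; letter \<open>2\<close> moves the right
    component to \<open>1\<close> only and so avoids this.\<close>
  have origin: "U 0 0"
  proof -
    obtain w where w: "\<And>i j. i < m \<Longrightarrow> j < n \<Longrightarrow> w \<in> S i j \<longleftrightarrow> i = 1 \<and> j = 0"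
      using pos_column[of 0 1] m unfolding U_def by auto
    show ?thesis
      unfolding U_def using m n by (intro exI[of _ "2 # w"]) (auto simp: S2 w)
  qed
  have "U p q"
    using pos_column[of q p] pos_row[of p q] origin assms by (cases "p = 0"; cases "q = 0") auto
  then show ?thesis unfolding U_def S_def .
qed

section \<open>Transfer to arbitrary minimal DFAs\<close>

lemma subset_automaton_inequivalent:
  assumes m: "m \<ge> 2" and n: "n \<ge> 2"
    and A: "minimal_dfa A {0, 1, 2} (dfa_lang (left_dfa m))"
    and B: "minimal_dfa B {0, 1, 2} (dfa_lang (right_dfa n))"
    and sub: "R \<subseteq> dstates A \<times> dstates B" "S \<subseteq> dstates A \<times> dstates B"
    and eq: "equivalent_states (subset_automaton (shuffle_nfa A B)) R S"
  shows "R = S"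
proof -
  note rA = minimal_dfa_residuals[OF left_dfa[OF m] A]
  note rB = minimal_dfa_residuals[OF right_dfa[OF n] B]
  have AB: "complete_dfa A" "complete_dfa B" "dalphabet B = dalphabet A"
    using A B by (auto simp: minimal_dfa_def recognizes_def)
  note accepts = subset_automaton_shuffle_nfa_lang_from[OF AB]
  have residual_A: "\<exists>i<m. dfa_lang_from A s = dfa_lang_from (left_dfa m) i" if "s \<in> dstates A" for s
    using imageI[OF that, of "dfa_lang_from A"] unfolding rA(2) by (auto simp: left_dfa_def)
  have residual_B: "\<exists>j<n. dfa_lang_from B t = dfa_lang_from (right_dfa n) j" if "t \<in> dstates B" for t
    using imageI[OF that, of "dfa_lang_from B"] unfolding rB(2) by (auto simp: right_dfa_def)
  have "(s, t) \<in> R \<longleftrightarrow> (s, t) \<in> S" if st: "s \<in> dstates A" "t \<in> dstates B" for s t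
  proof -
    obtain p q where pq: "p < m" "dfa_lang_from A s = dfa_lang_from (left_dfa m) p"
      "q < n" "dfa_lang_from B t = dfa_lang_from (right_dfa n) q"
      using residual_A residual_B st by metis
    obtain w where w: "\<And>i j. i < m \<Longrightarrow> j < n \<Longrightarrow>
        w \<in> shuffle_lang (dfa_lang_from (left_dfa m) i) (dfa_lang_from (right_dfa n) j) \<longleftrightarrow>
        i = p \<and> j = q"
      using unique_word[OF m n pq(1,3)] by blast
    have w': "w \<in> shuffle_lang (dfa_lang_from A s') (dfa_lang_from B t') \<longleftrightarrow> s' = s \<and> t' = t"
      if st': "s' \<in> dstates A" "t' \<in> dstates B" for s' t'
    proof -
      obtain i j where ij: "i < m" "dfa_lang_from A s' = dfa_lang_from (left_dfa m) i"
        "j < n" "dfa_lang_from B t' = dfa_lang_from (right_dfa n) j"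
        using residual_A residual_B st' by metis
      \<comment> \<open>States are determined by their languages both in \<open>A\<close> and in
        \<open>left_dfa m\<close>, so equality of indices and equality of states amount to the same
        equality of languages.\<close>
      have "i = p \<longleftrightarrow> s' = s"
        unfolding inj_on_eq_iff[OF rA(3) st'(1) st(1), symmetric]
        using left_dfa(2)[OF m] pq(1,2) ij(1,2)
        by (auto simp: reduced_dfa_def left_dfa_def inj_on_eq_iff)
      moreover have "j = q \<longleftrightarrow> t' = t"
        unfolding inj_on_eq_iff[OF rB(3) st'(2) st(2), symmetric]
        using right_dfa(2)[OF n] pq(3,4) ij(3,4)
        by (auto simp: reduced_dfa_def right_dfa_def inj_on_eq_iff)
      ultimately show ?thesis
        using w[OF ij(1,3)] ij(2,4) by simp
    qed
    \<comment> \<open>Acceptance of \<open>w\<close> reveals whether \<open>(s, t)\<close> belongs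
      to a set, so equivalent sets agree on every pair.\<close>
    have "w \<in> dfa_lang_from (subset_automaton (shuffle_nfa A B)) T \<longleftrightarrow> (s, t) \<in> T"
      if "T \<subseteq> dstates A \<times> dstates B" for T
      unfolding accepts[OF that] using that w' by fastforce
    from this[OF sub(1)] this[OF sub(2)] eq show ?thesis by (simp add: equivalent_states_def)
  qed
  with sub show ?thesis by auto
qed

theorem theorem16:
  fixes m n :: nat
  assumes "m \<ge> 2" and "n \<ge> 2"
  shows "\<exists>(\<Sigma> :: nat set) K L.
    card \<Sigma> = 3 \<and>
    regular_over \<Sigma> K \<and> regular_over \<Sigma> L \<and>
    state_complexity \<Sigma> K = m \<and> state_complexity \<Sigma> L = n \<and>
    (\<forall>A B. minimal_dfa A \<Sigma> K \<and> minimal_dfa B \<Sigma> L \<longrightarrow>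
       nfa_lang (shuffle_nfa A B) = shuffle_lang K L \<and>
       card (nstates (shuffle_nfa A B)) = m * n \<and>
       card (dstates (subset_automaton (shuffle_nfa A B))) = 2 ^ (m * n) \<and>
       (\<forall>R \<in> dstates (subset_automaton (shuffle_nfa A B)).
          \<forall>S \<in> dstates (subset_automaton (shuffle_nfa A B)).
            R \<noteq> S \<longrightarrow> \<not> equivalent_states (subset_automaton (shuffle_nfa A B)) R S))"
proof (intro exI conjI allI impI ballI; (elim conjE)?)
  let ?K = "dfa_lang (left_dfa m)" and ?L = "dfa_lang (right_dfa n)" and ?\<Sigma> = "{0, 1, 2} :: nat set"
  note K = left_dfa[OF assms(1)] and L = right_dfa[OF assms(2)]
  show "card ?\<Sigma> = 3" by simp
  show "regular_over ?\<Sigma> ?K" "regular_over ?\<Sigma> ?L"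
    using K L by (auto simp: regular_over_def)
  show "state_complexity ?\<Sigma> ?K = m" "state_complexity ?\<Sigma> ?L = n"
    \<comment> \<open>Both witnesses are reduced, so their numbers of states are the state
      complexities.\<close>
    unfolding reduced_dfa_state_complexity[OF K] reduced_dfa_state_complexity[OF L]
    by (simp_all add: left_dfa_def right_dfa_def)
  fix A B :: "(nat, nat) dfa"
  assume A: "minimal_dfa A ?\<Sigma> ?K" and B: "minimal_dfa B ?\<Sigma> ?L"
  have AB: "dfa_lang A = ?K" "dfa_lang B = ?L" "dalphabet B = dalphabet A"
    "finite (dstates A)" "finite (dstates B)"
    using A B by (auto simp: minimal_dfa_def recognizes_def complete_dfa_def)
  show "nfa_lang (shuffle_nfa A B) = shuffle_lang ?K ?L"
    using nfa_lang_shuffle_nfa[OF AB(3)] AB(1,2) by simp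
  show card: "card (nstates (shuffle_nfa A B)) = m * n"
    using minimal_dfa_residuals(1)[OF K A] minimal_dfa_residuals(1)[OF L B]
    by (simp add: shuffle_nfa_def card_cartesian_product left_dfa_def right_dfa_def)
  have "finite (nstates (shuffle_nfa A B))"
    using AB by (simp add: shuffle_nfa_def)
  with card show "card (dstates (subset_automaton (shuffle_nfa A B))) = 2 ^ (m * n)"
    by (simp add: subset_automaton_def card_Pow)
  fix R S
  assume "R \<in> dstates (subset_automaton (shuffle_nfa A B))"
    "S \<in> dstates (subset_automaton (shuffle_nfa A B))" "R \<noteq> S"
  then show "\<not> equivalent_states (subset_automaton (shuffle_nfa A B)) R S"
    using subset_automaton_inequivalent[OF assms A B, of R S]
    by (auto simp: subset_automaton_def shuffle_nfa_def)
qed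

end
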